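(* Let $p$ be an odd prime and let $n$ and $k$ be integers coprime to $p$. Then $$\sum_{\chi \bmod p} \left|\sum_{m=1}^{p-1}\left|\sum_{a=1}^{p-1} \chi(ma+n\overline{a})\, e\!\left(\frac{ka}{p}\right)\right|^2\right|^2=(p-1)(p^4-7p^3+17p^2-5p-25).$$
   Context: For an integer $a$ coprime to $p$, $\overline{a}$ denotes an integer with $a\overline{a}\equiv 1 \pmod p$ (and $\overline{a}=0$ if $p\mid a$). $e(y)=e^{2\pi i y}$. The outer sum runs over all $p-1$ Dirichlet characters $\chi$ modulo $p$; every character (including the principal character $\chi_0$) takes the value $0$ at multiples of $p$, and $\chi_0(x)=1$ when $p\nmid x$. *)

theory Defs
  imports
    Complex_Main
    "HOL-Number_Theory.Number_Theory"
begin

definition dirichlet_character :: "int \<Rightarrow> (int \<Rightarrow> complex) \<Rightarrow> bool" where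
  "dirichlet_character q chi \<longleftrightarrow>
     (\<forall>a b. chi (a * b) = chi a * chi b) \<and>
     (\<forall>a. chi (a + q) = chi a) \<and>
     (\<forall>a. chi a = 0 \<longleftrightarrow> \<not> coprime a q)"

definition dirichlet_characters :: "int \<Rightarrow> (int \<Rightarrow> complex) set" where
  "dirichlet_characters q = {chi. dirichlet_character q chi}"

definition e2pi :: "real \<Rightarrow> complex" where
  "e2pi y = exp (2 * of_real pi * \<i> * of_real y)"

lemma dirichlet_character_principal:
  "dirichlet_character q (\<lambda>a. if coprime a q then 1 else 0)"
proof -
  have "coprime (a + q) q \<longleftrightarrow> coprime a q" for a
    by (simp add: coprime_iff_gcd_eq_1)
  then show ?thesis
    by (auto simp: dirichlet_character_def)
qed

lemma dirichlet_character_mod: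
  assumes "dirichlet_character q chi"
  shows   "chi (a mod q) = chi a"
proof -
  have nat_shift: "chi (x + int j * q) = chi x" for x j
  proof (induction j)
    case (Suc j)
    have "chi (x + int (Suc j) * q) = chi ((x + int j * q) + q)"
      by (simp add: algebra_simps)
    with Suc assms show ?case
      by (metis dirichlet_character_def)
  qed simp
  have "chi (x + j * q) = chi x" for x j
  proof (cases "j \<ge> 0")
    case True
    then show ?thesis using nat_shift[of x "nat j"] by simp
  next
    case False
    then show ?thesis using nat_shift[of "x + j * q" "nat (- j)"] by simp
  qed
  from this[of "a mod q" "a div q"] show ?thesis by simp
qed

lemma dirichlet_character_root_of_unity:
  assumes "dirichlet_character q chi" "q > 0" "coprime a q"
  shows   "chi a ^ totient (nat q) = 1"
proof -
  have mult: "chi (x * y) = chi x * chi y" for x y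
    using assms(1) by (simp add: dirichlet_character_def)
  have "chi 1 \<noteq> 0"
    using assms(1) by (auto simp: dirichlet_character_def)
  with mult[of 1 1] have one: "chi 1 = 1" by simp
  have power: "chi (x ^ j) = chi x ^ j" for x j
    by (induction j) (simp_all add: one mult)
  have "[a ^ totient (nat q) = 1] (mod q)"
  proof (cases "q = 1")
    case False
    with assms(2) have "residues q" by unfold_locales auto
    then show ?thesis using residues.euler_theorem assms(3) by blast
  qed simp
  then have "chi (a ^ totient (nat q)) = chi 1"
    by (metis cong_def dirichlet_character_mod[OF assms(1)])
  then show ?thesis by (simp add: power one)
qed

text \<open>
  Finiteness matters here: sums over infinite sets are \<open>0\<close> by convention.
\<close>
lemma finite_dirichlet_characters:
  assumes "q > 0"
  shows   "finite (dirichlet_characters q)"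
proof -
  let ?V = "insert 0 {z :: complex. z ^ totient (nat q) = 1}"
  have fin: "finite ({0..<q} \<rightarrow>\<^sub>E ?V)"
    using assms by (intro finite_PiE finite.insertI finite_roots_unity) (auto simp: Suc_le_eq)
  have "(\<lambda>chi. restrict chi {0..<q}) ` dirichlet_characters q \<subseteq> {0..<q} \<rightarrow>\<^sub>E ?V"
  proof (intro image_subsetI restrict_PiE_iff[THEN iffD2] ballI)
    fix chi a assume "chi \<in> dirichlet_characters q"
    then have "dirichlet_character q chi" by (simp add: dirichlet_characters_def)
    then show "chi a \<in> ?V"
      using dirichlet_character_root_of_unity[OF _ assms]
      by (cases "coprime a q") (auto simp: dirichlet_character_def)
  qed
  moreover have "inj_on (\<lambda>chi. restrict chi {0..<q}) (dirichlet_characters q)"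
  proof (rule inj_onI, rule ext)
    fix chi psi :: "int \<Rightarrow> complex" and a
    assume *: "chi \<in> dirichlet_characters q" "psi \<in> dirichlet_characters q"
      and eq: "restrict chi {0..<q} = restrict psi {0..<q}"
    have "chi (a mod q) = psi (a mod q)"
      using fun_cong[OF eq, of "a mod q"] assms by simp
    then show "chi a = psi a"
      using * by (simp add: dirichlet_characters_def dirichlet_character_mod)
  qed
  ultimately show ?thesis
    using fin by (meson finite_imageD finite_subset)
qed

end

theory Submission
  imports Defs
begin

text \<open>
  Since \<open>\<chi>(ma + n/a) = \<chi>(a) \<chi>(m + n/a\<^sup>2)\<close>, expanding the square and summing over \<open>m\<close> first
  leaves correlations \<open>\<Sum>\<^sub>m \<chi>(m + c) cnj \<chi>(m + d)\<close>, which only depend on whether \<open>c \<equiv> d\<close>, that is,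
  whether \<open>a \<equiv> \<plusminus>b\<close>. The sums over \<open>a\<close> and \<open>b\<close> are then squared absolute values of Gauss sums plus
  a diagonal and an antidiagonal. The second moment is \<open>p(p - 3 - \<chi>(-1))\<close> for nonprincipal \<open>\<chi>\<close> and
  \<open>2p - 5\<close> for the principal one. Its square is affine in \<open>\<chi>(-1) = \<plusminus>1\<close>, so the sum over \<open>\<chi>\<close> only needs
  the number \<open>p - 1\<close> of characters and \<open>\<Sum>\<^sub>\<chi> \<chi>(-1) = 0\<close>; both come from a primitive root.
\<close>

section \<open>Sums over residue classes\<close>

text \<open>Multiplication by a unit permutes the nonzero residue classes. The first assumption is
  periodicity: it lets \<open>f\<close> ignore the reduction modulo \<open>q\<close> in the
  reindexing map.\<close>

lemma sum_mult_coprime_residues: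
  fixes f :: "int \<Rightarrow> 'a::comm_monoid_add" and q u :: int
  assumes "\<And>x. f (x mod q) = f x" and "coprime u q"
  shows "(\<Sum>x=1..q-1. f (u * x)) = (\<Sum>x=1..q-1. f x)"
proof -
  have eq: "{1..q-1} = {1..<q}" by auto
  have "(\<Sum>x\<in>{1..<q}. f (u * x mod q)) = (\<Sum>x\<in>{1..<q}. f x)"
    by (rule sum.reindex_bij_betw[OF bij_betw_int_remainders_mult[OF assms(2)]])
  then show ?thesis by (simp only: eq assms(1))
qed

lemma sum_shift_residues:
  fixes f :: "int \<Rightarrow> 'a::comm_monoid_add" and q c :: int
  assumes "\<And>x. f (x mod q) = f x"
  shows "(\<Sum>x=0..<q. f (x + c)) = (\<Sum>x=0..<q. f x)"
proof -
  have "bij_betw (\<lambda>x. (x + c) mod q) {0..<q} {0..<q}"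
    by (rule bij_betwI[of _ _ _ "\<lambda>x. (x - c) mod q"]) (auto simp: mod_simps)
  from sum.reindex_bij_betw[OF this, of f] show ?thesis
    by (simp only: assms)
qed

lemma sum_residues_split:
  fixes f :: "int \<Rightarrow> 'a::comm_monoid_add" and q :: int
  assumes "q > 0"
  shows "(\<Sum>x=0..<q. f x) = f 0 + (\<Sum>x=1..q-1. f x)"
proof -
  have "{0..<q} = insert 0 {1..q-1}" using assms by auto
  then show ?thesis by simp
qed

section \<open>Dirichlet characters\<close>

lemma dirichlet_character_mult:
  "dirichlet_character q chi \<Longrightarrow> chi (a * b) = chi a * chi b"
  by (simp add: dirichlet_character_def)

lemma dirichlet_character_eq_0_iff:
  "dirichlet_character q chi \<Longrightarrow> chi a = 0 \<longleftrightarrow> \<not> coprime a q"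
  by (simp add: dirichlet_character_def)

lemma dirichlet_character_one:
  assumes "dirichlet_character q chi"
  shows "chi 1 = 1"
  using dirichlet_character_mult[OF assms, of 1 1] dirichlet_character_eq_0_iff[OF assms, of 1]
  by simp

lemma dirichlet_character_power:
  "dirichlet_character q chi \<Longrightarrow> chi (a ^ j) = chi a ^ j"
  by (induction j) (simp_all add: dirichlet_character_one dirichlet_character_mult)

lemma dirichlet_character_cong:
  "dirichlet_character q chi \<Longrightarrow> [a = b] (mod q) \<Longrightarrow> chi a = chi b"
  by (metis cong_def dirichlet_character_mod)

text \<open>On units the values are roots of unity, hence of modulus 1, so conjugation is
  inversion.\<close>

lemma dirichlet_character_mult_cnj:
  assumes "dirichlet_character q chi" "q > 0" "coprime a q"
  shows "chi a * cnj (chi a) = 1"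
proof -
  have "cmod (chi a) ^ totient (nat q) = 1"
    using dirichlet_character_root_of_unity[OF assms] by (metis norm_one norm_power)
  then have "cmod (chi a) = 1"
    using assms(2) power_eq_iff_eq_base[of "totient (nat q)" "cmod (chi a)" 1] by simp
  then show ?thesis
    by (simp add: complex_norm_square[symmetric])
qed

lemma dirichlet_character_times:
  assumes "dirichlet_character q chi" "dirichlet_character q psi"
  shows "dirichlet_character q (\<lambda>a. chi a * psi a)"
  using assms by (simp add: dirichlet_character_def)

lemma dirichlet_character_cnj:
  assumes "dirichlet_character q chi"
  shows "dirichlet_character q (\<lambda>a. cnj (chi a))"
  using assms by (simp add: dirichlet_character_def)

definition principal_character :: "int \<Rightarrow> int \<Rightarrow> complex" where
  "principal_character q a = (if coprime a q then 1 else 0)"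

lemma principal_character: "dirichlet_character q (principal_character q)"
  using dirichlet_character_principal by (simp add: principal_character_def[abs_def])

text \<open>Allows results carrying the indicator of the principal character to be applied to the
  conjugate character with the same indicator.\<close>

lemma cnj_eq_principal_character_iff:
  "(\<lambda>a. cnj (chi a)) = principal_character q \<longleftrightarrow> chi = principal_character q"
proof -
  have "cnj (principal_character q a) = principal_character q a" for a
    by (simp add: principal_character_def)
  then show ?thesis
    by (metis complex_cnj_cnj ext)
qed

text \<open>The substitution of \<open>c * x\<close> for \<open>x\<close> multiplies the sum by
  \<open>chi c\<close>; a unit \<open>c\<close> with \<open>chi c\<close> different from 1 therefore
  forces it to vanish.\<close>

lemma sum_nonprincipal_character:
  assumes chi: "dirichlet_character q chi" and "chi \<noteq> principal_character q"
  shows "(\<Sum>x=1..q-1. chi x) = 0"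
proof -
  \<comment> \<open>Both characters vanish off the units, so a point where they differ is a
    unit.\<close>
  obtain c where "chi c \<noteq> principal_character q c"
    using assms(2) by blast
  then have c: "coprime c q" "chi c \<noteq> 1"
    using dirichlet_character_eq_0_iff[OF chi, of c]
    by (auto simp: principal_character_def split: if_splits)
  have "(\<Sum>x=1..q-1. chi x) = (\<Sum>x=1..q-1. chi (c * x))"
    by (rule sum_mult_coprime_residues[symmetric])
      (simp_all add: c dirichlet_character_mod[OF chi])
  also have "\<dots> = chi c * (\<Sum>x=1..q-1. chi x)"
    by (simp add: dirichlet_character_mult[OF chi] sum_distrib_left)
  finally show ?thesis using c(2) by simp
qed

section \<open>Characters modulo an odd prime and primitive roots\<close>

locale odd_prime_modulus =
  fixes p :: int
  assumes prime_p: "prime p" and odd_p: "odd p"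
begin

lemma p_ge_3: "p \<ge> 3"
  using prime_p odd_p prime_ge_2_int[of p] by (cases "p = 2") auto

lemma coprime_p_iff: "coprime a p \<longleftrightarrow> \<not> p dvd a"
  using prime_p by (metis coprime_commute prime_imp_coprime coprime_absorb_left not_prime_unit)

lemma coprime_unit: "a \<in> {1..p-1} \<Longrightarrow> coprime a p"
  by (auto simp: coprime_p_iff dest: zdvd_imp_le)

lemma sum_character:
  assumes "dirichlet_character p chi"
  shows "(\<Sum>x=1..p-1. chi x) = (of_int p - 1) * of_bool (chi = principal_character p)"
proof (cases "chi = principal_character p")
  case True
  have "(\<Sum>x=1..p-1. chi x) = (\<Sum>x=1..p-1. 1)"
    by (rule sum.cong) (use coprime_unit True in \<open>auto simp: principal_character_def\<close>)
  then show ?thesis using True p_ge_3 by simp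
qed (simp add: sum_nonprincipal_character[OF assms])

lemma character_0: "dirichlet_character p chi \<Longrightarrow> chi 0 = 0"
  using dirichlet_character_eq_0_iff[of p chi 0] p_ge_3 by simp

lemma character_minus_one:
  assumes "dirichlet_character p chi"
  shows "chi (-1) = 1 \<or> chi (-1) = -1"
  using dirichlet_character_mult[OF assms, of "-1" "-1"] dirichlet_character_one[OF assms]
  by (simp add: square_eq_1_iff)

text \<open>Carries the primitive root from natural numbers over to integers. The last property says
  that \<open>g\<close> has order exactly \<open>p - 1\<close>.\<close>

lemma primitive_root:
  obtains g :: int
  where "coprime g p"
    and "\<And>a. coprime a p \<Longrightarrow> \<exists>i::nat. [g ^ i = a] (mod p)"
    and "\<And>i j. [g ^ i = g ^ j] (mod p) \<longleftrightarrow> [i = j] (mod (nat p - 1))"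
proof -
  define q where "q = nat p"
  have p: "p = int q" using p_ge_3 by (simp add: q_def)
  have q: "prime q" using prime_p p by simp
  obtain g where g: "g \<in> totatives q" "ord q g = q - 1"
    using residue_prime_has_primroot[OF q] by blast
  then have root: "residue_primroot q g"
    using q by (auto simp: residue_primroot_def totatives_def totient_prime coprime_commute prime_gt_0_nat)
  then have cop: "coprime q g" by (simp add: residue_primroot_def)
  show ?thesis
  proof (rule that)
    show "coprime (int g) p" using cop p by (simp add: coprime_commute)
    show "\<exists>i::nat. [int g ^ i = a] (mod p)" if "coprime a p" for a
    proof -
      have "nat (a mod p) \<in> totatives q"
      proof -
        have "a mod p \<noteq> 0" using that coprime_p_iff by auto
        moreover have "0 \<le> a mod p" "a mod p < p" using p_ge_3 by auto
        moreover have "coprime (a mod p) p" using that by (simp add: coprime_p_iff dvd_mod_iff)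
        ultimately show ?thesis
          unfolding totatives_def p by (auto simp flip: coprime_int_iff)
      qed
      then obtain i where "g ^ i mod q = nat (a mod p)"
        using residue_primroot_is_generator[OF prime_gt_1_nat[OF q] root]
        unfolding bij_betw_def by (metis (no_types, lifting) imageE)
      then have "int g ^ i mod p = a mod p"
        using p_ge_3 unfolding p by (metis of_nat_mod of_nat_power int_nat_eq p pos_mod_sign
            q prime_gt_0_nat of_nat_0_less_iff)
      then show ?thesis by (auto simp: cong_def)
    qed
    show "[int g ^ i = int g ^ j] (mod p) \<longleftrightarrow> [i = j] (mod (nat p - 1))" for i j
      using order_divides_expdiff[OF cop, of i j] g(2)
      by (simp add: p cong_int_iff flip: of_nat_power)
  qed
qed

text \<open>A character is determined by its value at a generator, and every root of unity of order
  dividing \<open>p - 1\<close> is such a value. This both counts the characters and allows one to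
  be prescribed.\<close>

lemma primitive_root_characters:
  obtains g :: int
  where "coprime g p"
    and "\<And>a. coprime a p \<Longrightarrow> \<exists>i::nat. [g ^ i = a] (mod p)"
    and "\<And>i j. [g ^ i = g ^ j] (mod p) \<longleftrightarrow> [i = j] (mod (nat p - 1))"
    and "bij_betw (\<lambda>chi. chi g) (dirichlet_characters p) {z. z ^ (nat p - 1) = 1}"
proof -
  obtain g :: int where g: "coprime g p"
    "\<And>a. coprime a p \<Longrightarrow> \<exists>i::nat. [g ^ i = a] (mod p)"
    "\<And>i j. [g ^ i = g ^ j] (mod p) \<longleftrightarrow> [i = j] (mod (nat p - 1))"
    using primitive_root by metis
  have tot: "totient (nat p) = nat p - 1"
    using prime_p by (simp add: totient_prime)
  have "bij_betw (\<lambda>chi. chi g) (dirichlet_characters p) {z. z ^ (nat p - 1) = 1}"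
  proof (rule bij_betwI')
    fix chi psi assume "chi \<in> dirichlet_characters p" "psi \<in> dirichlet_characters p"
    then have chi: "dirichlet_character p chi" and psi: "dirichlet_character p psi"
      by (simp_all add: dirichlet_characters_def)
    show "chi g = psi g \<longleftrightarrow> chi = psi"
    proof
      assume eq: "chi g = psi g"
      show "chi = psi"
      proof
        fix a
        show "chi a = psi a"
        proof (cases "coprime a p")
          case True
          then obtain i :: nat where i: "[g ^ i = a] (mod p)" using g(2) by blast
          show ?thesis
            using dirichlet_character_cong[OF chi i] dirichlet_character_cong[OF psi i] eq
            by (simp add: dirichlet_character_power[OF chi] dirichlet_character_power[OF psi])
        next
          case False
          then show ?thesis
            using dirichlet_character_eq_0_iff chi psi by metis
        qed
      qed
    qed simp
  next
    fix chi assume "chi \<in> dirichlet_characters p"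
    then show "chi g \<in> {z. z ^ (nat p - 1) = 1}"
      using dirichlet_character_root_of_unity[of p chi g] g(1) p_ge_3 tot
      by (simp add: dirichlet_characters_def)
  next
    fix z :: complex assume "z \<in> {z. z ^ (nat p - 1) = 1}"
    then have z: "z ^ (nat p - 1) = 1" by simp
    \<comment> \<open>A discrete logarithm to base \<open>g\<close>. The choice is arbitrary, but
      two choices agree modulo \<open>p - 1\<close>, which \<open>z ^ (nat p - 1) = 1\<close> makes
      invisible in the power of \<open>z\<close>.\<close>
    define ind :: "int \<Rightarrow> nat" where "ind a = (SOME i. [g ^ i = a] (mod p))" for a
    have ind: "[g ^ ind a = a] (mod p)" if "coprime a p" for a
      unfolding ind_def by (rule someI_ex) (rule g(2)[OF that])
    have zpow: "z ^ i = z ^ j" if "[i = j] (mod (nat p - 1))" for i j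
    proof -
      have red: "z ^ i = z ^ (i mod (nat p - 1))" for i
      proof -
        have "z ^ i = z ^ ((nat p - 1) * (i div (nat p - 1)) + i mod (nat p - 1))" by simp
        also have "\<dots> = z ^ (i mod (nat p - 1))"
          unfolding power_add power_mult z by simp
        finally show ?thesis .
      qed
      show ?thesis using that red[of i] red[of j] by (simp add: cong_def)
    qed
    have zind: "z ^ i = z ^ ind a" if "[g ^ i = a] (mod p)" "coprime a p" for i a
      using that ind[of a] g(3) zpow cong_trans cong_sym by blast
    define chi where "chi a = (if coprime a p then z ^ ind a else 0)" for a
    have "dirichlet_character p chi"
      unfolding dirichlet_character_def
    proof (intro conjI allI)
      fix a b
      show "chi (a * b) = chi a * chi b"
      proof (cases "coprime a p \<and> coprime b p")
        case True
        then have "[g ^ (ind a + ind b) = a * b] (mod p)"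
          unfolding power_add by (intro cong_mult ind) auto
        from zind[OF this] True show ?thesis
          by (simp add: chi_def power_add)
      qed (auto simp: chi_def)
    next
      fix a
      \<comment> \<open>The predicates defining \<open>ind (a + p)\<close> and \<open>ind a\<close>
        coincide, so the choice operator returns the same exponent.\<close>
      have "[g ^ i = a + p] (mod p) \<longleftrightarrow> [g ^ i = a] (mod p)" for i
        by (simp add: cong_def)
      then have "ind (a + p) = ind a" by (simp add: ind_def)
      moreover have "coprime (a + p) p \<longleftrightarrow> coprime a p"
        by (simp add: coprime_p_iff)
      ultimately show "chi (a + p) = chi a" by (simp add: chi_def)
    next
      fix a
      have "z \<noteq> 0" using z p_ge_3 by (auto simp: power_0_left split: if_splits)
      then show "chi a = 0 \<longleftrightarrow> \<not> coprime a p" by (simp add: chi_def)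
    qed
    moreover have "chi g = z"
      using zind[of 1 g] g(1) by (simp add: chi_def)
    ultimately show "\<exists>chi\<in>dirichlet_characters p. z = chi g"
      by (auto simp: dirichlet_characters_def)
  qed
  with g that show ?thesis by blast
qed

lemma card_dirichlet_characters: "card (dirichlet_characters p) = nat p - 1"
proof -
  obtain g where "bij_betw (\<lambda>chi. chi g) (dirichlet_characters p) {z. z ^ (nat p - 1) = 1}"
    using primitive_root_characters by metis
  from bij_betw_same_card[OF this] show ?thesis
    using p_ge_3 by (simp add: card_roots_unity_eq)
qed

text \<open>With \<open>c\<close> a nontrivial power of the generator, the character sending the
  generator to a primitive root of unity of order \<open>p - 1\<close> takes a nontrivial value at
  \<open>c\<close>.\<close>

lemma separating_character:
  assumes "coprime c p" and "\<not> [c = 1] (mod p)"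
  obtains chi where "dirichlet_character p chi" and "chi c \<noteq> 1"
proof -
  let ?N = "nat p - 1"
  obtain g where g: "\<And>a. coprime a p \<Longrightarrow> \<exists>i::nat. [g ^ i = a] (mod p)"
    "\<And>i j. [g ^ i = g ^ j] (mod p) \<longleftrightarrow> [i = j] (mod ?N)"
    and bij: "bij_betw (\<lambda>chi. chi g) (dirichlet_characters p) {z. z ^ ?N = 1}"
    using primitive_root_characters by metis
  have N: "?N > 0" using p_ge_3 by simp
  obtain i :: nat where i: "[g ^ i = c] (mod p)" using g(1)[OF assms(1)] by blast
  \<comment> \<open>Reduction brings the exponent into the range on which the roots of unity
    \<open>?f\<close> are distinct, so \<open>?f j\<close> can be compared with
    \<open>?f 0 = 1\<close>.\<close>
  define j where "j = i mod ?N"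
  have "[g ^ j = c] (mod p)"
    using g(2)[of j i] i by (auto simp: j_def cong_def)
  have "j < ?N" using N by (simp add: j_def)
  moreover have "j \<noteq> 0"
    using assms(2) \<open>[g ^ j = c] (mod p)\<close> by (auto simp: cong_sym_eq intro!: gr0I)
  ultimately have j: "j < ?N" "j \<noteq> 0" .
  let ?f = "\<lambda>k::nat. cis (2 * pi * real k / real ?N)"
  have f: "bij_betw ?f {..<?N} {z. z ^ ?N = 1}"
    by (rule bij_betw_roots_unity[OF N])
  have "?f 1 \<in> {z. z ^ ?N = 1}"
    by (rule bij_betw_apply[OF f]) (use p_ge_3 in simp)
  then obtain chi where chi: "chi \<in> dirichlet_characters p" "chi g = ?f 1"
    using bij unfolding bij_betw_def by (metis (no_types, lifting) imageE)
  then have char: "dirichlet_character p chi" by (simp add: dirichlet_characters_def)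
  have "chi c = chi g ^ j"
    using dirichlet_character_cong[OF char \<open>[g ^ j = c] (mod p)\<close>]
    by (simp add: dirichlet_character_power[OF char])
  also have "\<dots> = ?f j"
    unfolding chi(2) by (simp add: DeMoivre mult_ac)
  also have "\<dots> \<noteq> ?f 0"
    using f j N unfolding bij_betw_def inj_on_def by (metis lessThan_iff)
  finally show ?thesis using that[OF char] by simp
qed

text \<open>Multiplication by a character \<open>psi\<close> with \<open>psi c\<close> different
  from 1 permutes all characters and scales the sum by \<open>psi c\<close>.\<close>

lemma sum_over_characters:
  assumes "coprime c p" and "\<not> [c = 1] (mod p)"
  shows "(\<Sum>chi\<in>dirichlet_characters p. chi c) = 0"
proof -
  obtain psi where psi: "dirichlet_character p psi" "psi c \<noteq> 1"
    using separating_character[OF assms] by blast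
  let ?X = "dirichlet_characters p"
  have p0: "p > 0" using p_ge_3 by simp
  \<comment> \<open>Multiplication by \<open>cnj psi\<close> undoes multiplication by
    \<open>psi\<close>: on units the product of the two is 1, and elsewhere \<open>chi\<close> is 0
    anyway.\<close>
  have cancel: "cnj (psi a) * (psi a * chi a) = chi a" "psi a * (cnj (psi a) * chi a) = chi a"
    if "dirichlet_character p chi" for chi a
    using dirichlet_character_mult_cnj[OF psi(1) p0, of a] dirichlet_character_eq_0_iff[OF that, of a]
    by (cases "coprime a p"; simp add: mult_ac; metis mult.assoc mult.commute mult.right_neutral)+
  have "bij_betw (\<lambda>chi a. psi a * chi a) ?X ?X"
    by (rule bij_betwI[of _ _ _ "\<lambda>chi a. cnj (psi a) * chi a"])
      (auto simp: dirichlet_characters_def cancel fun_eq_iff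
        intro!: dirichlet_character_times psi(1) dirichlet_character_cnj)
  from sum.reindex_bij_betw[OF this, of "\<lambda>chi. chi c"]
  have "(\<Sum>chi\<in>?X. chi c) = psi c * (\<Sum>chi\<in>?X. chi c)"
    by (simp add: sum_distrib_left)
  then show ?thesis using psi(2) by simp
qed

section \<open>Correlations of shifts and Gauss sums\<close>

text \<open>
  The correlation at lag \<open>t\<close> only depends on whether \<open>p\<close> divides \<open>t\<close>, and its average over \<open>t\<close>
  is a product of two complete character sums.
\<close>
lemma character_shift_correlation:
  assumes chi: "dirichlet_character p chi"
  shows "(\<Sum>x=0..<p. chi (x + c) * cnj (chi (x + d))) =
    (if p dvd c - d then of_int p - 1
     else (of_int p - 1) * of_bool (chi = principal_character p) - 1)"
proof -
  let ?P = "of_bool (chi = principal_character p) :: complex"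
  have p0: "p > 0" and p1: "of_int p - (1::complex) \<noteq> 0"
    using p_ge_3 by (simp_all add: of_int_eq_1_iff)
  define F where "F t = (\<Sum>x=1..p-1. chi (x + t) * cnj (chi x))" for t
  note cong = dirichlet_character_cong[OF chi] and mod = dirichlet_character_mod[OF chi]
  have per: "chi (x mod p + y) = chi (x + y)" for x y
    by (rule cong) (simp add: cong_def mod_simps)
  have shift: "(\<Sum>x=0..<p. chi (x + c) * cnj (chi (x + d))) = F (c - d)"
  proof -
    have "(\<Sum>x=0..<p. chi (x + c) * cnj (chi (x + d))) =
        (\<Sum>x=0..<p. (\<lambda>y. chi (y + (c - d)) * cnj (chi y)) (x + d))"
      by (simp add: algebra_simps)
    also have "\<dots> = (\<Sum>y=0..<p. chi (y + (c - d)) * cnj (chi y))"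
      by (rule sum_shift_residues) (simp only: per mod)
    also have "\<dots> = F (c - d)"
      using p0 by (subst sum_residues_split) (simp_all add: F_def character_0[OF chi])
    finally show ?thesis .
  qed
  have F0: "F t = of_int p - 1" if "p dvd t" for t
  proof -
    have "F t = (\<Sum>x=1..p-1. 1)"
      unfolding F_def
    proof (rule sum.cong)
      fix x assume x: "x \<in> {1..p-1}"
      have "chi (x + t) = chi x"
        by (rule cong) (use that in \<open>simp add: cong_iff_dvd_diff\<close>)
      then show "chi (x + t) * cnj (chi x) = 1"
        using dirichlet_character_mult_cnj[OF chi p0 coprime_unit[OF x]] by simp
    qed simp
    then show ?thesis using p0 by simp
  qed
  \<comment> \<open>Scaling \<open>x\<close> by the unit \<open>t\<close> turns the shift by
    \<open>t\<close> into a shift by 1, at the cost of a factor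
    \<open>chi t * cnj (chi t) = 1\<close>.\<close>
  have F1: "F t = F 1" if "coprime t p" for t
  proof -
    have "F t = (\<Sum>x=1..p-1. chi (t * x + t) * cnj (chi (t * x)))"
      unfolding F_def by (rule sum_mult_coprime_residues[symmetric]) (simp_all only: per mod that)
    also have "\<dots> = (\<Sum>x=1..p-1. (chi t * cnj (chi t)) * (chi (x + 1) * cnj (chi x)))"
    proof (rule sum.cong)
      fix x
      have "chi (t * x + t) = chi t * chi (x + 1)"
        by (simp add: dirichlet_character_mult[OF chi, symmetric] algebra_simps)
      then show "chi (t * x + t) * cnj (chi (t * x)) =
          (chi t * cnj (chi t)) * (chi (x + 1) * cnj (chi x))"
        by (simp add: dirichlet_character_mult[OF chi])
    qed simp
    also have "\<dots> = F 1"
      by (simp add: dirichlet_character_mult_cnj[OF chi p0 that] F_def)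
    finally show ?thesis .
  qed
  \<comment> \<open>After the exchange of sums the inner sum over \<open>t\<close> runs through a
    complete period and no longer depends on \<open>x\<close>.\<close>
  have "(\<Sum>t=0..<p. F t) = (\<Sum>x=1..p-1. (\<Sum>t=0..<p. chi (t + x)) * cnj (chi x))"
    unfolding F_def by (subst sum.swap) (simp add: sum_distrib_right add.commute)
  also have "\<dots> = (\<Sum>x=1..p-1. (\<Sum>t=0..<p. chi t) * cnj (chi x))"
    by (subst sum_shift_residues) (simp_all add: mod)
  also have "\<dots> = (\<Sum>t=1..p-1. chi t) * cnj (\<Sum>x=1..p-1. chi x)"
    using p0 by (simp add: sum_residues_split character_0[OF chi] sum_distrib_left)
  also have "\<dots> = (of_int p - 1)\<^sup>2 * ?P"
    by (simp add: sum_character[OF chi] power2_eq_square)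
  finally have "(\<Sum>t=0..<p. F t) = (of_int p - 1)\<^sup>2 * ?P" .
  moreover have "(\<Sum>t=0..<p. F t) = (of_int p - 1) + (\<Sum>t=1..p-1. F 1)"
  proof -
    have "(\<Sum>t=1..p-1. F t) = (\<Sum>t=1..p-1. F 1)"
      by (rule sum.cong[OF refl]) (rule F1[OF coprime_unit])
    then show ?thesis
      using F0[of 0] by (simp add: sum_residues_split[OF p0])
  qed
  \<comment> \<open>The two evaluations of the total give one linear equation for the single unknown
    \<open>F 1\<close>.\<close>
  ultimately have "(of_int p - 1) * (F 1 + 1) = (of_int p - 1) * ((of_int p - 1) * ?P)"
    using p0 by (simp add: algebra_simps power2_eq_square)
  then have "F 1 + 1 = (of_int p - 1) * ?P"
    using p1 by (simp only: mult_cancel_left) simp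
  then have "F 1 = (of_int p - 1) * ?P - 1"
    by (simp add: algebra_simps)
  then show ?thesis
    unfolding shift using F0[of "c - d"] F1[of "c - d"] by (simp add: coprime_p_iff)
qed

section \<open>Additive characters modulo \<open>p\<close> and Gauss sums\<close>

definition add_char :: "int \<Rightarrow> complex" where
  "add_char x = e2pi (of_int x / of_int p)"

lemma add_char_eq_cis: "add_char x = cis (2 * pi * (of_int x / of_int p))"
  by (simp add: add_char_def e2pi_def cis_conv_exp mult_ac)

lemma add_char_add: "add_char (x + y) = add_char x * add_char y"
  by (simp add: add_char_eq_cis cis_mult add_divide_distrib distrib_left)

lemma add_char_0: "add_char 0 = 1"
  by (simp add: add_char_def e2pi_def)

lemma cnj_add_char: "cnj (add_char x) = add_char (- x)"
  by (simp add: add_char_eq_cis cis_cnj)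

lemma add_char_eq_1_iff: "add_char x = 1 \<longleftrightarrow> p dvd x"
proof -
  have p: "real_of_int p \<noteq> 0" using p_ge_3 by simp
  have "add_char x = 1 \<longleftrightarrow> (\<exists>n::int. real_of_int x / real_of_int p = of_int n)"
  proof -
    \<comment> \<open>Once the cosine is 1 the sine vanishes, so only the real part of
      \<open>cis y\<close> has to be compared.\<close>
    have "sin y = 0" if "cos y = 1" for y :: real
      using sin_cos_squared_add[of y] that by simp
    then have "cis y = 1 \<longleftrightarrow> cos y = 1" for y
      by (auto simp: complex_eq_iff)
    then show ?thesis
      using p by (simp add: add_char_eq_cis cos_one_2pi_int divide_simps mult_ac)
  qed
  also have "\<dots> \<longleftrightarrow> (\<exists>n::int. real_of_int x = of_int (p * n))"
    using p by (simp add: field_simps)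
  also have "\<dots> \<longleftrightarrow> p dvd x"
    unfolding of_int_eq_iff by (auto simp: dvd_def)
  finally show ?thesis .
qed

lemma add_char_cong:
  assumes "[x = y] (mod p)"
  shows "add_char x = add_char y"
proof -
  have "add_char (x - y) = 1"
    using assms by (simp add: add_char_eq_1_iff cong_iff_dvd_diff)
  then show ?thesis
    using add_char_add[of "x - y" y] by simp
qed

text \<open>When \<open>t\<close> is a unit, the sum over a complete period is unchanged by a shift
  of 1, which multiplies it by \<open>add_char 1\<close>, a number different from 1; so it is 0. The
  value -1 comes from omitting the term at 0.\<close>

lemma sum_add_char:
  "(\<Sum>x=1..p-1. add_char (t * x)) = (if p dvd t then of_int p - 1 else -1)"
proof (cases "p dvd t")
  case True
  then have "add_char (t * x) = 1" for x by (simp add: add_char_eq_1_iff)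
  then show ?thesis using True p_ge_3 by simp
next
  case False
  have per: "add_char (x mod p) = add_char x" for x
    by (rule add_char_cong) (simp add: cong_def)
  have "(\<Sum>x=0..<p. add_char x) = (\<Sum>x=0..<p. add_char (x + 1))"
    by (rule sum_shift_residues[symmetric]) (rule per)
  also have "\<dots> = add_char 1 * (\<Sum>x=0..<p. add_char x)"
    by (simp add: add_char_add sum_distrib_left mult.commute)
  finally have "(\<Sum>x=0..<p. add_char x) = 0"
    using add_char_eq_1_iff[of 1] p_ge_3 by auto
  then have "1 + (\<Sum>x=1..p-1. add_char x) = 0"
    using p_ge_3 by (simp add: sum_residues_split add_char_0)
  moreover have "(\<Sum>x=1..p-1. add_char (t * x)) = (\<Sum>x=1..p-1. add_char x)"
    by (rule sum_mult_coprime_residues) (use False in \<open>simp_all add: per coprime_p_iff\<close>)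
  ultimately show ?thesis
    using False by (simp add: add_eq_0_iff)
qed

text \<open>The squared modulus is \<open>p\<close> for nonprincipal and 1 for principal characters.
  Scaling one summation variable by the other leaves a sum of additive characters, whose
  orthogonality singles out \<open>a = 1\<close>.\<close>

lemma gauss_sum_mult_cnj:
  assumes chi: "dirichlet_character p chi" and "coprime k p"
  shows "(\<Sum>a=1..p-1. chi a * add_char (k * a)) * cnj (\<Sum>a=1..p-1. chi a * add_char (k * a)) =
    of_int p - (of_int p - 1) * of_bool (chi = principal_character p)"
proof -
  have p0: "p > 0" using p_ge_3 by simp
  have "(\<Sum>a=1..p-1. chi a * add_char (k * a)) * cnj (\<Sum>a=1..p-1. chi a * add_char (k * a)) =
      (\<Sum>b=1..p-1. (\<Sum>a=1..p-1. chi a * add_char (k * a)) * (cnj (chi b) * add_char (- (k * b))))"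
    by (simp add: sum_distrib_left cnj_add_char)
  also have "\<dots> = (\<Sum>b=1..p-1. \<Sum>a=1..p-1. chi a * add_char ((k * (a - 1)) * b))"
  proof (rule sum.cong)
    fix b assume "b \<in> {1..p-1}"
    then have b: "coprime b p" by (rule coprime_unit)
    \<comment> \<open>Replacing \<open>a\<close> by \<open>b * a\<close> makes the values at
      \<open>b\<close> cancel and merges the two phases into \<open>k * (a - 1) * b\<close>.\<close>
    have "(\<Sum>a=1..p-1. chi a * add_char (k * a)) = (\<Sum>a=1..p-1. chi (b * a) * add_char (k * (b * a)))"
      by (rule sum_mult_coprime_residues[symmetric, where f = "\<lambda>a. chi a * add_char (k * a)"])
        (auto simp: b dirichlet_character_mod[OF chi] cong_def mod_simps
          intro!: arg_cong2[where f = "(*)"] add_char_cong)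
    then have "(\<Sum>a=1..p-1. chi a * add_char (k * a)) * (cnj (chi b) * add_char (- (k * b))) =
      (\<Sum>a=1..p-1. (chi b * cnj (chi b)) *
        (chi a * (add_char (k * (b * a)) * add_char (- (k * b)))))"
      by (simp add: dirichlet_character_mult[OF chi] sum_distrib_left sum_distrib_right mult_ac)
    also have "\<dots> = (\<Sum>a=1..p-1. chi a * add_char ((k * (a - 1)) * b))"
      by (simp add: dirichlet_character_mult_cnj[OF chi p0 b] add_char_add[symmetric] algebra_simps)
    finally show "(\<Sum>a=1..p-1. chi a * add_char (k * a)) * (cnj (chi b) * add_char (- (k * b))) =
      (\<Sum>a=1..p-1. chi a * add_char ((k * (a - 1)) * b))" .
  qed simp
  also have "\<dots> = (\<Sum>a=1..p-1. chi a * (\<Sum>b=1..p-1. add_char ((k * (a - 1)) * b)))"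
    by (subst sum.swap) (simp add: sum_distrib_left)
  also have "\<dots> = (\<Sum>a=1..p-1. chi a * (if p dvd k * (a - 1) then of_int p - 1 else -1))"
    unfolding sum_add_char ..
  \<comment> \<open>The weight \<open>p - 1\<close> is split as \<open>p\<close> plus the uniform
    weight -1.\<close>
  also have "\<dots> = (\<Sum>a=1..p-1. (if a = 1 then of_int p else 0) - chi a)"
  proof (rule sum.cong)
    fix a assume a: "a \<in> {1..p-1}"
    have "p dvd k * (a - 1) \<longleftrightarrow> p dvd a - 1"
      using assms(2) by (simp add: coprime_dvd_mult_right_iff coprime_commute)
    also have "\<dots> \<longleftrightarrow> a = 1"
      using a zdvd_not_zless[of "a - 1" p] by (cases "a = 1") auto
    finally show "chi a * (if p dvd k * (a - 1) then of_int p - 1 else -1) =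
        (if a = 1 then of_int p else 0) - chi a"
      by (simp add: dirichlet_character_one[OF chi])
  qed simp
  also have "\<dots> = of_int p - (of_int p - 1) * of_bool (chi = principal_character p)"
    using p_ge_3 by (simp add: sum_subtractf sum_character[OF chi])
  finally show ?thesis .
qed

section \<open>The second moment for a fixed character\<close>

text \<open>The indicator \<open>P\<close> of the principal character lets both cases be treated by one computation.\<close>

lemma sum_twisted_shifts:
  assumes chi: "dirichlet_character p chi" and n: "coprime n p"
    and a: "a \<in> {1..p-1}" and b: "b \<in> {1..p-1}"
  defines "P \<equiv> of_bool (chi = principal_character p) :: complex"
  shows "(\<Sum>m=1..p-1. chi (m * a + n * modular_inverse p a) *
      cnj (chi (m * b + n * modular_inverse p b))) =
    chi a * cnj (chi b) * ((of_int p - 1) * P - 1 + (of_int p - (of_int p - 1) * P) *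
      ((if b = a then 1 else 0) + (if b = p - a then 1 else 0))) - cnj (chi a) * chi b"
proof -
  have p0: "p > 0" using p_ge_3 by simp
  note mult = dirichlet_character_mult[OF chi] and mult_cnj = dirichlet_character_mult_cnj[OF chi p0]
  define A where "A = modular_inverse p a"
  define B where "B = modular_inverse p b"
  note cop = coprime_unit[OF a] coprime_unit[OF b]
  have inv: "[a * A = 1] (mod p)" "[b * B = 1] (mod p)"
    unfolding A_def B_def by (rule cong_modular_inverse1[OF cop(1)] cong_modular_inverse1[OF cop(2)])+
  \<comment> \<open>With \<open>C\<close> inverse to \<open>c\<close>, the term \<open>n * C\<close>
    equals \<open>c * (n * C * C)\<close> modulo \<open>p\<close>, so \<open>c\<close> can be pulled
    out.\<close>
  have factor: "chi (m * c + n * C) = chi c * chi (m + n * C\<^sup>2)" if "[c * C = 1] (mod p)" for m c C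
  proof -
    have "[m * c + n * (1 * C) = m * c + n * ((c * C) * C)] (mod p)"
      using that by (intro cong_add cong_mult cong_refl) (rule cong_sym)
    then have "[m * c + n * C = c * (m + n * C\<^sup>2)] (mod p)"
      by (simp add: algebra_simps power2_eq_square)
    from dirichlet_character_cong[OF chi this] show ?thesis by (simp only: mult)
  qed
  have chi_inv: "chi C = cnj (chi c)" if "[c * C = 1] (mod p)" "coprime c p" for c C
  proof -
    have "chi c * chi C = 1"
      using dirichlet_character_cong[OF chi that(1)] by (simp add: mult dirichlet_character_one[OF chi])
    then show ?thesis
      using mult_cnj[OF that(2)] by (metis mult.assoc mult.commute mult.right_neutral)
  qed
  \<comment> \<open>The shifts coincide modulo \<open>p\<close> exactly when the squares of
    \<open>a\<close> and \<open>b\<close> do, which for a prime modulus means that \<open>b\<close>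
    is congruent to \<open>a\<close> or \<open>-a\<close>.\<close>
  have "p dvd n * A\<^sup>2 - n * B\<^sup>2 \<longleftrightarrow> [n * A\<^sup>2 = n * B\<^sup>2] (mod p)"
    by (simp add: cong_iff_dvd_diff)
  also have "\<dots> \<longleftrightarrow> [A\<^sup>2 = B\<^sup>2] (mod p)"
    using n by (simp add: cong_mult_lcancel)
  also have "\<dots> \<longleftrightarrow> [b\<^sup>2 = a\<^sup>2] (mod p)"
  proof
    have inv2: "[a\<^sup>2 * A\<^sup>2 = 1] (mod p)" "[b\<^sup>2 * B\<^sup>2 = 1] (mod p)"
      using cong_pow[OF inv(1), of 2] cong_pow[OF inv(2), of 2] by (simp_all add: power_mult_distrib)
    {
      assume "[A\<^sup>2 = B\<^sup>2] (mod p)"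
      then have "[(a\<^sup>2 * b\<^sup>2) * A\<^sup>2 = (a\<^sup>2 * b\<^sup>2) * B\<^sup>2] (mod p)"
        by (intro cong_mult cong_refl)
      moreover have "[(a\<^sup>2 * b\<^sup>2) * A\<^sup>2 = b\<^sup>2] (mod p)" "[(a\<^sup>2 * b\<^sup>2) * B\<^sup>2 = a\<^sup>2] (mod p)"
        using cong_mult[OF cong_refl[of "b\<^sup>2"] inv2(1)] cong_mult[OF cong_refl[of "a\<^sup>2"] inv2(2)]
        by (simp_all add: mult_ac)
      ultimately show "[b\<^sup>2 = a\<^sup>2] (mod p)" by (metis cong_sym cong_trans)
    next
      assume "[b\<^sup>2 = a\<^sup>2] (mod p)"
      then have "[(A\<^sup>2 * B\<^sup>2) * b\<^sup>2 = (A\<^sup>2 * B\<^sup>2) * a\<^sup>2] (mod p)"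
        by (intro cong_mult cong_refl)
      moreover have "[(A\<^sup>2 * B\<^sup>2) * b\<^sup>2 = A\<^sup>2] (mod p)" "[(A\<^sup>2 * B\<^sup>2) * a\<^sup>2 = B\<^sup>2] (mod p)"
        using cong_mult[OF cong_refl[of "A\<^sup>2"] inv2(2)] cong_mult[OF cong_refl[of "B\<^sup>2"] inv2(1)]
        by (simp_all add: mult_ac)
      ultimately show "[A\<^sup>2 = B\<^sup>2] (mod p)" by (metis cong_sym cong_trans)
    }
  qed
  also have "\<dots> \<longleftrightarrow> p dvd (b - a) * (b + a)"
    by (simp add: cong_iff_dvd_diff algebra_simps power2_eq_square)
  also have "\<dots> \<longleftrightarrow> p dvd b - a \<or> p dvd b + a"
    by (rule prime_dvd_mult_iff[OF prime_p])
  also have "p dvd b - a \<longleftrightarrow> b = a"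
    using a b zdvd_not_zless[of "b - a" p] zdvd_not_zless[of "a - b" p]
    by (cases a b rule: linorder_cases) (auto simp: dvd_diff_commute)
  also have "p dvd b + a \<longleftrightarrow> b = p - a"
  proof
    assume "p dvd b + a"
    then have "p dvd b + a - p" by simp
    then show "b = p - a"
      using a b zdvd_not_zless[of "b + a - p" p] zdvd_not_zless[of "p - (b + a)" p]
      by (cases "b + a" p rule: linorder_cases) (auto simp: dvd_diff_commute)
  qed simp
  finally have dvd: "p dvd n * A\<^sup>2 - n * B\<^sup>2 \<longleftrightarrow> b = a \<or> b = p - a" .
  \<comment> \<open>The diagonal and antidiagonal indicators are never both 1, so their sum is the
    indicator of the disjunction.\<close>
  have ne: "a \<noteq> p - a" using odd_p by presburger
  \<comment> \<open>This is the term at \<open>m = 0\<close>, contained in the correlation over a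
    complete period but not in the sum over \<open>m\<close>; it becomes the subtracted
    \<open>cnj (chi a) * chi b\<close>.\<close>
  have zero: "chi (n * A\<^sup>2) * cnj (chi (n * B\<^sup>2)) = (cnj (chi a))\<^sup>2 * (chi b)\<^sup>2"
    using mult_cnj[OF n] chi_inv[OF inv(1) cop(1)] chi_inv[OF inv(2) cop(2)]
    by (simp add: mult power2_eq_square mult_ac)
  have "(\<Sum>x=0..<p. chi (x + n * A\<^sup>2) * cnj (chi (x + n * B\<^sup>2))) =
      (cnj (chi a))\<^sup>2 * (chi b)\<^sup>2 + (\<Sum>m=1..p-1. chi (m + n * A\<^sup>2) * cnj (chi (m + n * B\<^sup>2)))"
    by (subst sum_residues_split[OF p0]) (simp add: zero)
  moreover have "(\<Sum>m=1..p-1. chi (m * a + n * A) * cnj (chi (m * b + n * B))) =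
      chi a * cnj (chi b) * (\<Sum>m=1..p-1. chi (m + n * A\<^sup>2) * cnj (chi (m + n * B\<^sup>2)))"
    unfolding factor[OF inv(1)] factor[OF inv(2)] sum_distrib_left
    by (intro sum.cong refl) (simp add: mult_ac)
  moreover have "chi a * cnj (chi b) * ((cnj (chi a))\<^sup>2 * (chi b)\<^sup>2) =
      (chi a * cnj (chi a)) * (chi b * cnj (chi b)) * (cnj (chi a) * chi b)"
    by (simp add: power2_eq_square mult_ac)
  ultimately have "(\<Sum>m=1..p-1. chi (m * a + n * A) * cnj (chi (m * b + n * B))) =
      chi a * cnj (chi b) * (if b = a \<or> b = p - a then of_int p - 1 else (of_int p - 1) * P - 1)
      - cnj (chi a) * chi b"
    unfolding character_shift_correlation[OF chi] dvd P_def[symmetric] mult_cnj[OF cop(1)] mult_cnj[OF cop(2)]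
    by (simp add: algebra_simps)
  also have "(if b = a \<or> b = p - a then of_int p - 1 else (of_int p - 1) * P - 1) =
      (of_int p - 1) * P - 1 + (of_int p - (of_int p - 1) * P) *
      ((if b = a then 1 else 0) + (if b = p - a then 1 else 0))"
    using ne by auto
  finally show ?thesis unfolding A_def B_def .
qed

text \<open>Three contributions are added: a constant times a squared Gauss sum, the diagonal with
  the antidiagonal, and the correction for the missing \<open>m = 0\<close>. All carry the factor
  \<open>D\<close>. The value is \<open>p * (p - 3 - chi (-1))\<close> for nonprincipal and
  \<open>2 * p - 5\<close> for principal \<open>chi\<close>.\<close>

lemma second_moment:
  assumes chi: "dirichlet_character p chi" and n: "coprime n p" and k: "coprime k p"
  defines "P \<equiv> of_bool (chi = principal_character p) :: complex"
  shows "of_real (\<Sum>m=1..p-1. (cmod (\<Sum>a=1..p-1.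
      chi (m * a + n * modular_inverse p a) * add_char (k * a)))\<^sup>2) =
    (of_int p - (of_int p - 1) * P) * ((of_int p - 1) * P + of_int p - 3 - chi (-1))"
proof -
  have p0: "p > 0" using p_ge_3 by simp
  let ?U = "{1..p-1}"
  \<comment> \<open>\<open>L\<close> is the generic correlation and \<open>D\<close> its jump to
    \<open>p - 1\<close> when the shifts coincide. The same \<open>D\<close> is also the squared
    modulus of the Gauss sum.\<close>
  define L D where "L = (of_int p - 1) * P - 1" and "D = of_int p - (of_int p - 1) * P"
  define X where "X m a = chi (m * a + n * modular_inverse p a)" for m a
  define w where "w a b = add_char (k * a) * cnj (add_char (k * b))" for a b
  define d where "d a b = (if b = a then 1 else 0) + (if b = p - a then 1 else 0 :: complex)" for a b
  have "of_real (\<Sum>m\<in>?U. (cmod (\<Sum>a\<in>?U. X m a * add_char (k * a)))\<^sup>2) =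
      (\<Sum>m\<in>?U. \<Sum>a\<in>?U. \<Sum>b\<in>?U. w a b * (X m a * cnj (X m b)))"
    by (simp add: complex_norm_square sum_product w_def mult_ac del: of_real_power)
  also have "\<dots> = (\<Sum>a\<in>?U. \<Sum>m\<in>?U. \<Sum>b\<in>?U. w a b * (X m a * cnj (X m b)))"
    by (rule sum.swap)
  also have "\<dots> = (\<Sum>a\<in>?U. \<Sum>b\<in>?U. \<Sum>m\<in>?U. w a b * (X m a * cnj (X m b)))"
    by (rule sum.cong[OF refl], rule sum.swap)
  also have "\<dots> = (\<Sum>a\<in>?U. \<Sum>b\<in>?U. w a b * (\<Sum>m\<in>?U. X m a * cnj (X m b)))"
    by (simp add: sum_distrib_left)
  also have "\<dots> = (\<Sum>a\<in>?U. \<Sum>b\<in>?U. w a b *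
      (chi a * cnj (chi b) * (L + D * d a b) - cnj (chi a) * chi b))"
    unfolding X_def L_def D_def d_def P_def
    by (intro sum.cong refl arg_cong2[where f = "(*)"] sum_twisted_shifts[OF chi n])
  also have "\<dots> = (\<Sum>a\<in>?U. \<Sum>b\<in>?U. L * (w a b * (chi a * cnj (chi b))) +
      D * (w a b * (chi a * cnj (chi b)) * d a b) - w a b * (cnj (chi a) * chi b))"
    by (intro sum.cong refl) (simp add: algebra_simps)
  also have "\<dots> = L * (\<Sum>a\<in>?U. \<Sum>b\<in>?U. w a b * (chi a * cnj (chi b))) +
      D * (\<Sum>a\<in>?U. \<Sum>b\<in>?U. w a b * (chi a * cnj (chi b)) * d a b) -
      (\<Sum>a\<in>?U. \<Sum>b\<in>?U. w a b * (cnj (chi a) * chi b))"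
    by (simp only: sum_subtractf sum.distrib sum_distrib_left)
  also have "(\<Sum>a\<in>?U. \<Sum>b\<in>?U. w a b * (chi a * cnj (chi b))) = D"
    unfolding D_def P_def gauss_sum_mult_cnj[OF chi k, symmetric]
    unfolding w_def cnj_sum sum_product by (intro sum.cong refl) (simp add: mult_ac)
  also have "(\<Sum>a\<in>?U. \<Sum>b\<in>?U. w a b * (cnj (chi a) * chi b)) = D"
    unfolding D_def P_def gauss_sum_mult_cnj[OF dirichlet_character_cnj[OF chi] k,
        unfolded cnj_eq_principal_character_iff, symmetric]
    unfolding w_def cnj_sum sum_product by (intro sum.cong refl) (simp add: mult_ac)
  \<comment> \<open>Only \<open>b = a\<close> and \<open>b = p - a\<close> survive: the first has
    trivial phase, while in the second the phases reinforce to frequency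
    \<open>2 * k\<close>.\<close>
  also have "(\<Sum>a\<in>?U. \<Sum>b\<in>?U. w a b * (chi a * cnj (chi b)) * d a b) =
      (\<Sum>a\<in>?U. 1 + chi (-1) * add_char ((2 * k) * a))"
  proof (rule sum.cong)
    fix a assume a: "a \<in> ?U"
    then have a': "p - a \<in> ?U" by auto
    have one: "chi a * cnj (chi a) = 1"
      by (rule dirichlet_character_mult_cnj[OF chi p0 coprime_unit[OF a]])
    have "chi (p - a) = chi (-1 * a)"
      by (rule dirichlet_character_cong[OF chi]) (simp add: cong_iff_dvd_diff)
    then have "cnj (chi (p - a)) = chi (-1) * cnj (chi a)"
      using character_minus_one[OF chi] dirichlet_character_mult[OF chi, of "-1" a] by auto
    then have minus: "chi a * cnj (chi (p - a)) = chi (-1)"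
      using one by (simp add: mult_ac)
    have "w a (p - a) = add_char (k * a - k * (p - a))"
      by (simp add: w_def cnj_add_char add_char_add[symmetric])
    also have "\<dots> = add_char ((2 * k) * a)"
      by (rule add_char_cong) (simp add: cong_iff_dvd_diff algebra_simps)
    finally have w_minus: "w a (p - a) = add_char ((2 * k) * a)" .
    have w_same: "w a a = 1"
      by (simp add: w_def cnj_add_char add_char_add[symmetric] add_char_0)
    have "(\<Sum>b\<in>?U. w a b * (chi a * cnj (chi b)) * d a b) =
        (\<Sum>b\<in>?U. if b = a then w a b * (chi a * cnj (chi b)) else 0) +
        (\<Sum>b\<in>?U. if b = p - a then w a b * (chi a * cnj (chi b)) else 0)"
      unfolding sum.distrib[symmetric] d_def by (rule sum.cong) auto
    also have "\<dots> = w a a * (chi a * cnj (chi a)) + w a (p - a) * (chi a * cnj (chi (p - a)))"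
      using a a' by (simp only: sum.delta finite_atLeastAtMost_int if_True)
    finally show "(\<Sum>b\<in>?U. w a b * (chi a * cnj (chi b)) * d a b) =
        1 + chi (-1) * add_char ((2 * k) * a)"
      unfolding w_same w_minus minus one by (simp add: mult.commute)
  qed simp
  also have "(\<Sum>a\<in>?U. 1 + chi (-1) * add_char ((2 * k) * a)) = of_int p - 1 - chi (-1)"
  proof -
    \<comment> \<open>Since \<open>p\<close> is odd, the frequency \<open>2 * k\<close> is still a
      unit, and the additive sum is -1.\<close>
    have "\<not> p dvd 2 * k"
      using k p_ge_3 prime_p odd_p zdvd_imp_le[of p 2]
      by (auto simp: prime_dvd_mult_iff coprime_p_iff)
    then show ?thesis
      using p0 by (simp add: sum.distrib sum_distrib_left[symmetric] sum_add_char)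
  qed
  also have "L * D + D * (of_int p - 1 - chi (-1)) - D =
      D * ((of_int p - 1) * P + of_int p - 3 - chi (-1))"
    by (simp add: L_def algebra_simps)
  finally show ?thesis unfolding X_def D_def .
qed

end

section \<open>Summation over all characters\<close>

theorem theorem1p1:
  fixes p n k :: int
  assumes "prime p" and "odd p" and "coprime n p" and "coprime k p"
  shows "(\<Sum>chi\<in>dirichlet_characters p.
            \<bar>\<Sum>m=1..p-1. (cmod (\<Sum>a=1..p-1.
               chi (m * a + n * modular_inverse p a) * e2pi (of_int (k * a) / of_int p)))\<^sup>2\<bar>\<^sup>2)
         = of_int ((p - 1) * (p^4 - 7 * p^3 + 17 * p^2 - 5 * p - 25))"
proof -
  interpret odd_prime_modulus p
    using assms by unfold_locales
  let ?X = "dirichlet_characters p" and ?p = "of_int p :: complex"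
  define S where "S chi = (\<Sum>m=1..p-1. (cmod (\<Sum>a=1..p-1.
    chi (m * a + n * modular_inverse p a) * add_char (k * a)))\<^sup>2)" for chi
  \<comment> \<open>The square of the nonprincipal second moment, made affine in
    \<open>chi (-1)\<close> by using that its square is 1.\<close>
  define T where "T chi = ?p\<^sup>2 * ((?p - 3)\<^sup>2 + 1 - 2 * (?p - 3) * chi (-1))" for chi :: "int \<Rightarrow> complex"
  have fin: "finite ?X"
    using p_ge_3 by (intro finite_dirichlet_characters) simp
  have principal: "principal_character p \<in> ?X"
    by (simp add: dirichlet_characters_def principal_character)
  \<comment> \<open>\<open>T\<close> is used for every character; at the principal one it gives
    \<open>p\<^sup>2 * (p - 4)\<^sup>2\<close>, which is exchanged for the true value
    \<open>(2 * p - 5)\<^sup>2\<close>.\<close>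
  have "complex_of_real ((S chi)\<^sup>2) =
      T chi + (if chi = principal_character p then (2 * ?p - 5)\<^sup>2 - ?p\<^sup>2 * (?p - 4)\<^sup>2 else 0)"
    if "chi \<in> ?X" for chi
  proof -
    from that have chi: "dirichlet_character p chi" by (simp add: dirichlet_characters_def)
    have "chi (-1) = 1" if "chi = principal_character p"
      using that by (simp add: principal_character_def)
    then show ?thesis
      using character_minus_one[OF chi]
      unfolding of_real_power S_def second_moment[OF chi assms(3,4)] T_def
      by (auto simp: algebra_simps power2_eq_square)
  qed
  then have "complex_of_real (\<Sum>chi\<in>?X. (S chi)\<^sup>2) =
      (\<Sum>chi\<in>?X. T chi) + ((2 * ?p - 5)\<^sup>2 - ?p\<^sup>2 * (?p - 4)\<^sup>2)"
    using fin principal by (simp add: sum.distrib del: of_real_power)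
  also have "(\<Sum>chi\<in>?X. T chi) = (?p - 1) * (?p\<^sup>2 * ((?p - 3)\<^sup>2 + 1))"
  proof -
    have "\<not> [-1 = 1] (mod p)"
      using p_ge_3 zdvd_imp_le[of p 2] by (auto simp: cong_iff_dvd_diff)
    then have "(\<Sum>chi\<in>?X. chi (-1)) = 0"
      by (intro sum_over_characters) auto
    then show ?thesis
      using p_ge_3 unfolding T_def
      by (simp add: sum_distrib_left[symmetric] sum_subtractf card_dirichlet_characters)
  qed
  also have "(?p - 1) * (?p\<^sup>2 * ((?p - 3)\<^sup>2 + 1)) + ((2 * ?p - 5)\<^sup>2 - ?p\<^sup>2 * (?p - 4)\<^sup>2) =
      complex_of_real (of_int ((p - 1) * (p^4 - 7 * p^3 + 17 * p^2 - 5 * p - 25)))"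
    by (simp add: algebra_simps power2_eq_square power3_eq_cube power4_eq_xxxx)
  finally have "(\<Sum>chi\<in>?X. (S chi)\<^sup>2) =
      of_int ((p - 1) * (p^4 - 7 * p^3 + 17 * p^2 - 5 * p - 25))"
    unfolding of_real_eq_iff .
  then show ?thesis
    by (simp add: S_def add_char_def)
qed

end
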